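(* Let $q\geq 3$ and let $F\subset 2^{[n]}$ be a regular $q$-uniform hypergraph. Let $K\subseteq 2^{[n]}$ be the simplicial complex associated to $F$, in the sense that $F$ is the collection of all minimal non-faces of $K$. Then $$\frac{\epsilon(K)}{w(K)} \leq \frac{(q-1)^2}{q(q^2-q+1)} \leq \frac{4}{21}.$$
   Context: Let $[n]=\{1,\dots,n\}$. A simplicial complex $K\subseteq 2^{[n]}$ is a family of subsets of $[n]$ that contains $\emptyset$ and is closed under taking subsets; a minimal non-face is an inclusion-minimal subset of $[n]$ not in $K$. A hypergraph $F\subseteq 2^{[n]}$ is $q$-uniform if all its members have cardinality $q$, and regular if all elements of $[n]$ belong to the same number of members of $F$. Partition number: $\pi(K)$ is the minimum integer $k$ such that for each partition $A_1\uplus\dots\uplus A_k=[n]$ (blocks may be empty) at least one of the sets $A_i$ is in $K$. Threshold characteristic: let $\Delta_{[n]}$ be the simplex of probability measures on $[n]$ (nonnegative weights $x_i$ with $\sum x_i=1$, and $\mu(A)=\sum_{i\in A}x_i$). Put $T_{\mu\le\alpha}=\{A\subseteq [n]\mid \mu(A)\le\alpha\}$ and $T_{\mu<\alpha}=\{A\subseteq [n]\mid \mu(A)<\alpha\}$. Then $$\rho(K)=\sup\{\alpha\in[0,+\infty]\mid \exists\mu\in\Delta_{[n]},\ T_{\mu\le\alpha}\subseteq K\}=\max\{\alpha\in[0,+\infty]\mid \exists\mu\in\Delta_{[n]},\ T_{\mu<\alpha}\subseteq K\}.$$ Here $\rho(K)=+\infty$ iff $K=2^{[n]}$, and then $1/\rho(K)=0$.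 Non-linearity gap: $\epsilon(K)=\lfloor 1/\rho(K)\rfloor+1-\pi(K)$. The number $w(K)=n$ is the cardinality of the ground set $[n]$. *)

theory Defs
  imports Complex_Main "HOL-Library.Disjoint_Sets" "HOL-Library.Extended_Nonnegative_Real"
begin

definition simplicial_complex :: "nat \<Rightarrow> nat set set \<Rightarrow> bool" where
  "simplicial_complex n K \<longleftrightarrow>
     K \<subseteq> Pow {1..n} \<and> {} \<in> K \<and> (\<forall>A\<in>K. \<forall>B. B \<subseteq> A \<longrightarrow> B \<in> K)"

definition minimal_nonfaces :: "nat \<Rightarrow> nat set set \<Rightarrow> nat set set" where
  "minimal_nonfaces n K = {A. A \<subseteq> {1..n} \<and> A \<notin> K \<and> (\<forall>B. B \<subset> A \<longrightarrow> B \<in> K)}"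

definition uniform_hypergraph :: "nat \<Rightarrow> nat set set \<Rightarrow> bool" where
  "uniform_hypergraph q F \<longleftrightarrow> (\<forall>A\<in>F. card A = q)"

definition regular_hypergraph :: "nat \<Rightarrow> nat set set \<Rightarrow> bool" where
  "regular_hypergraph n F \<longleftrightarrow>
     (\<exists>d. \<forall>i\<in>{1..n}. card {A \<in> F. i \<in> A} = d)"

text \<open>
  Blocks of a partition may be empty. The restriction to positive \<open>k\<close> is essential: a nonempty
  ground set has no partition into zero blocks, so \<open>k = 0\<close> would satisfy the condition vacuously.
\<close>

definition partition_number :: "nat \<Rightarrow> nat set set \<Rightarrow> nat" where
  "partition_number n K =
     (LEAST k. 1 \<le> k \<and>
        (\<forall>A :: nat \<Rightarrow> nat set.
           disjoint_family_on A {1..k} \<and> (\<Union>i\<in>{1..k}. A i) = {1..n} \<longrightarrow>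
           (\<exists>i\<in>{1..k}. A i \<in> K)))"

text \<open>
  A probability measure on \<open>{1..n}\<close> is given by its weights; values of the weight function
  outside \<open>{1..n}\<close> are irrelevant.
\<close>

definition prob_simplex :: "nat \<Rightarrow> (nat \<Rightarrow> real) set" where
  "prob_simplex n = {x. (\<forall>i\<in>{1..n}. 0 \<le> x i) \<and> (\<Sum>i\<in>{1..n}. x i) = 1}"

definition threshold_complex :: "nat \<Rightarrow> (nat \<Rightarrow> real) \<Rightarrow> ennreal \<Rightarrow> nat set set" where
  "threshold_complex n x \<alpha> = {A. A \<subseteq> {1..n} \<and> ennreal (\<Sum>i\<in>A. x i) \<le> \<alpha>}"

definition threshold_char :: "nat \<Rightarrow> nat set set \<Rightarrow> ennreal" where
  "threshold_char n K = Sup {\<alpha>. \<exists>x\<in>prob_simplex n. threshold_complex n x \<alpha> \<subseteq> K}"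

text \<open>
  The quotient is taken in \<^typ>\<open>ennreal\<close>, where \<open>1 / \<infinity> = 0\<close>. For \<open>n \<ge> 1\<close> and a simplicial
  complex \<open>K\<close> the uniform measure shows that \<open>threshold_char n K\<close> is positive, so the quotient is
  finite and its conversion to a real number loses nothing.
\<close>

definition nonlinearity_gap :: "nat \<Rightarrow> nat set set \<Rightarrow> int" where
  "nonlinearity_gap n K =
     \<lfloor>enn2real (1 / threshold_char n K)\<rfloor> + 1 - int (partition_number n K)"

end

theory Submission
  imports Defs
begin

text \<open>
  A set with fewer than \<open>q\<close> elements contains no edge of \<open>F\<close> and is therefore a face, so the uniform
  measure gives \<open>1 / \<rho>(K) \<le> n / q\<close>; and a matching of \<open>m\<close> edges can be enlarged to a partition into
  \<open>m\<close> non-faces, so \<open>\<pi>(K) > m\<close>. It remains to find a matching with at least \<open>n / (q\<^sup>2 - q + 1)\<close> edges,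
  which is Furedi's bound applied to the constant fractional matching \<open>1 / d\<close> of total weight \<open>n / q\<close>,
  \<open>d\<close> being the degree. For the latter, one moves a fractional matching within its tight
  constraints, without losing weight, until some edge has weight at least \<open>1 / q\<close>. This succeeds,
  since otherwise double counting shows that there are more edges in the support than tight
  vertices, which leaves room for another move. Deleting the heavy edge and all edges meeting it costs
  weight at most \<open>q - 1 + 1 / q\<close>, and one iterates.
\<close>

section \<open>Linear systems and rays in polyhedra\<close>

text \<open>Gaussian elimination by induction on the equations: an equation with a nonzero
  coefficient is solved for one unknown \<open>p\<close>, which costs one equation and one unknown
  and so preserves the surplus of unknowns.\<close>

lemma underdetermined_homogeneous_system:
  fixes c :: "'t \<Rightarrow> 'a \<Rightarrow> real"
  assumes "finite T" "finite A" "card T < card A"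
  shows "\<exists>z. (\<exists>a\<in>A. z a \<noteq> 0) \<and> (\<forall>t\<in>T. (\<Sum>a\<in>A. c t a * z a) = 0)"
  using assms
proof (induction T arbitrary: A c rule: finite_induct)
  case empty
  then have "A \<noteq> {}" by auto
  then show ?case by (intro exI[of _ "\<lambda>_. 1"]) auto
next
  case (insert t T)
  show ?case
  proof (cases "\<forall>a\<in>A. c t a = 0")
    case True
    have "card T < card A" using insert by simp
    with insert.IH[OF insert.prems(1)] obtain z where
      "\<exists>a\<in>A. z a \<noteq> 0" "\<forall>t\<in>T. (\<Sum>a\<in>A. c t a * z a) = 0" by blast
    with True show ?thesis by (intro exI[of _ z]) auto
  next
    case False
    then obtain p where p: "p \<in> A" "c t p \<noteq> 0" by blast
    define B where "B = A - {p}"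
    have A: "A = insert p B" "p \<notin> B" "finite B"
      using p insert.prems by (auto simp: B_def)
    \<comment> \<open>Equation \<open>s\<close> minus the multiple of equation \<open>t\<close> that
      cancels the coefficient of \<open>p\<close>; for \<open>s = t\<close> nothing remains. Below,
      \<open>y\<close> recovers the value at \<open>p\<close> by back-substitution.\<close>
    define c' where "c' s a = c s a - c s p * c t a / c t p" for s a
    have "card T < card B" using insert A by simp
    from insert.IH[OF A(3) this, of c'] obtain z where
      z: "\<exists>a\<in>B. z a \<noteq> 0" "\<forall>s\<in>T. (\<Sum>a\<in>B. c' s a * z a) = 0" by blast
    define y where "y = z(p := - (\<Sum>a\<in>B. c t a * z a) / c t p)"
    have sum_y: "(\<Sum>a\<in>A. c s a * y a) = (\<Sum>a\<in>B. c' s a * z a)" for s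
    proof -
      have "(\<Sum>a\<in>A. c s a * y a) = c s p * y p + (\<Sum>a\<in>B. c s a * z a)"
        using A by (simp add: y_def) (intro sum.cong, auto)
      also have "c s p * y p = - (\<Sum>a\<in>B. c s p * c t a / c t p * z a)"
        by (simp add: y_def sum_distrib_left sum_divide_distrib mult_ac)
      finally show ?thesis
        by (simp add: c'_def left_diff_distrib sum_subtractf)
    qed
    have "c' t a = 0" for a using p by (simp add: c'_def)
    then have "\<forall>s\<in>insert t T. (\<Sum>a\<in>A. c s a * y a) = 0"
      using z(2) by (simp add: sum_y)
    moreover have "\<exists>a\<in>A. y a \<noteq> 0" using z(1) A by (auto simp: y_def)
    ultimately show ?thesis by blast
  qed
qed

text \<open>A pair \<open>(a, b)\<close> encodes the constraint \<open>0 \<le> a + s * b\<close>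
  along a ray with parameter \<open>s\<close>. The last feasible \<open>s\<close> is the least ratio
  \<open>a / - b\<close> over the decreasing constraints, and the one attaining it becomes
  tight.\<close>

lemma ray_exits_polyhedron:
  fixes P :: "(real \<times> real) set"
  assumes "finite P" "\<And>a b. (a, b) \<in> P \<Longrightarrow> 0 \<le> a" "(a0, b0) \<in> P" "b0 < 0"
  obtains s a b where "0 \<le> s" "\<forall>(a, b)\<in>P. 0 \<le> a + s * b"
    "(a, b) \<in> P" "b < 0" "a + s * b = 0"
proof -
  define N where "N = {p\<in>P. snd p < 0}"
  define s where "s = Min ((\<lambda>p. fst p / - snd p) ` N)"
  have N: "finite N" "N \<noteq> {}" using assms by (auto simp: N_def)
  then have "s \<in> (\<lambda>p. fst p / - snd p) ` N" unfolding s_def by (intro Min_in) auto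
  then obtain a b where ab: "(a, b) \<in> P" "b < 0" "s = a / - b" by (auto simp: N_def)
  have s0: "0 \<le> s" using ab assms(2)[OF ab(1)] by (simp add: divide_nonneg_neg)
  have "0 \<le> a' + s * b'" if ab': "(a', b') \<in> P" for a' b'
  proof (cases "b' < 0")
    case True
    then have "(a', b') \<in> N" using ab' by (simp add: N_def)
    then have "s \<le> a' / - b'" unfolding s_def using N by (intro Min_le) force+
    with True show ?thesis by (simp add: field_simps)
  next
    case False
    then show ?thesis using s0 assms(2)[OF ab'] by simp
  qed
  moreover have "a + s * b = 0" using ab by simp
  ultimately show ?thesis using that s0 ab(1,2) by blast
qed

section \<open>Fractional matchings\<close>

definition vertex_load :: "'a set set \<Rightarrow> ('a set \<Rightarrow> real) \<Rightarrow> 'a \<Rightarrow> real" where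
  "vertex_load H w v = (\<Sum>e\<in>{e\<in>H. v \<in> e}. w e)"

definition fractional_matching :: "'a set set \<Rightarrow> ('a set \<Rightarrow> real) \<Rightarrow> bool" where
  "fractional_matching H w \<longleftrightarrow> (\<forall>e\<in>H. 0 \<le> w e) \<and> (\<forall>v. vertex_load H w v \<le> 1)"

lemma vertex_load_add_scaled:
  "vertex_load H (\<lambda>e. w e + s * z e) v = vertex_load H w v + s * vertex_load H z v"
  by (simp add: vertex_load_def sum.distrib sum_distrib_left)

text \<open>Double counting of incidences. It is applied with \<open>T\<close> the set of tight
  vertices, a single edge, and the whole ground set.\<close>

lemma sum_vertex_load:
  assumes "finite H" "finite T"
  shows "(\<Sum>v\<in>T. vertex_load H w v) = (\<Sum>e\<in>H. w e * real (card (e \<inter> T)))"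
proof -
  have "(\<Sum>v\<in>T. vertex_load H w v) = (\<Sum>e\<in>H. \<Sum>v\<in>{v\<in>T. v \<in> e}. w e)"
    unfolding vertex_load_def using assms(2,1) by (rule sum.swap_restrict)
  also have "\<dots> = (\<Sum>e\<in>H. w e * real (card (e \<inter> T)))"
    by (intro sum.cong) (auto simp: Int_def conj_commute mult.commute)
  finally show ?thesis .
qed

lemma fractional_matching_mono:
  assumes "fractional_matching H w" "finite H" "H' \<subseteq> H"
  shows "fractional_matching H' w"
proof -
  have "vertex_load H' w v \<le> vertex_load H w v" for v
    unfolding vertex_load_def using assms
    by (intro sum_mono2) (auto simp: fractional_matching_def)
  with assms show ?thesis
    unfolding fractional_matching_def by (meson order_trans subsetD)
qed

lemma fractional_matching_le_1:
  assumes "fractional_matching H w" "finite H" "e \<in> H" "e \<noteq> {}"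
  shows "w e \<le> 1"
proof -
  from assms obtain v where "v \<in> e" by blast
  have "w e \<le> vertex_load H w v"
    unfolding vertex_load_def using assms \<open>v \<in> e\<close>
    by (intro member_le_sum) (auto simp: fractional_matching_def)
  also have "\<dots> \<le> 1" using assms by (simp add: fractional_matching_def)
  finally show ?thesis .
qed

text \<open>Each edge of the support contributes at most \<open>r * w e < 1\<close> to the total
  load of the tight vertices, so these are fewer than the support edges. Hence the system "zero load
  at every tight vertex", with unknowns on the support, has a nontrivial solution.\<close>

lemma light_matching_direction:
  fixes w :: "'a set \<Rightarrow> real"
  assumes H: "finite H" "\<And>e. e \<in> H \<Longrightarrow> finite e" "\<And>e. e \<in> H \<Longrightarrow> card e \<le> r"
    and w: "fractional_matching H w" and light: "\<And>e. e \<in> H \<Longrightarrow> r * w e < 1"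
    and pos: "e0 \<in> H" "w e0 \<noteq> 0"
  shows "\<exists>z :: 'a set \<Rightarrow> real. (\<exists>e\<in>H. z e \<noteq> 0) \<and> (\<forall>e\<in>H. w e = 0 \<longrightarrow> z e = 0) \<and> 0 \<le> sum z H \<and>
           (\<forall>v\<in>\<Union>H. vertex_load H w v = 1 \<longrightarrow> vertex_load H z v = 0)"
proof -
  define S where "S = {e\<in>H. w e \<noteq> 0}"
  define T where "T = {v\<in>\<Union>H. vertex_load H w v = 1}"
  have fin: "finite S" "finite T" using H by (auto simp: S_def T_def)
  have "real (card T) = (\<Sum>v\<in>T. vertex_load H w v)" by (simp add: T_def)
  also have "\<dots> = (\<Sum>e\<in>H. w e * real (card (e \<inter> T)))"
    by (rule sum_vertex_load[OF H(1) fin(2)])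
  also have "\<dots> = (\<Sum>e\<in>S. w e * real (card (e \<inter> T)))"
    using H(1) by (intro sum.mono_neutral_right) (auto simp: S_def)
  also have "\<dots> < (\<Sum>e\<in>S. 1)"
  proof (rule sum_strict_mono)
    fix e assume "e \<in> S"
    then have e: "e \<in> H" by (simp add: S_def)
    have "card (e \<inter> T) \<le> r"
      using card_mono[OF H(2)[OF e], of "e \<inter> T"] H(3)[OF e] by simp
    moreover have "0 \<le> w e" using w e by (simp add: fractional_matching_def)
    ultimately have "w e * real (card (e \<inter> T)) \<le> w e * real r"
      by (intro mult_left_mono) auto
    also have "\<dots> < 1" using light[OF e] by (simp add: mult.commute)
    finally show "w e * real (card (e \<inter> T)) < 1" .
  qed (use fin pos in \<open>auto simp: S_def\<close>)
  finally have "card T < card S" by simp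
  from underdetermined_homogeneous_system[OF fin(2,1) this, of "\<lambda>v e. if v \<in> e then 1 else 0"]
  obtain y :: "'a set \<Rightarrow> real" where y: "\<exists>e\<in>S. y e \<noteq> 0"
    "\<forall>v\<in>T. (\<Sum>e\<in>S. (if v \<in> e then 1 else 0) * y e) = 0" by blast
  \<comment> \<open>Solutions of a homogeneous system may be negated, so the sign is chosen to make
    the total weight nondecreasing along \<open>z\<close>.\<close>
  define \<sigma> :: real where "\<sigma> = (if sum y S \<ge> 0 then 1 else - 1)"
  define z where "z e = (if e \<in> S then \<sigma> * y e else 0)" for e
  have "\<exists>e\<in>H. z e \<noteq> 0" using y(1) by (auto simp: z_def S_def \<sigma>_def)
  moreover have "\<forall>e\<in>H. w e = 0 \<longrightarrow> z e = 0" by (simp add: z_def S_def)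
  moreover have "sum z H = \<sigma> * sum y S"
    unfolding sum_distrib_left using H(1)
    by (intro sum.mono_neutral_cong_right) (auto simp: S_def z_def)
  then have "0 \<le> sum z H" by (simp add: \<sigma>_def)
  moreover have "vertex_load H z v = 0" if "v \<in> T" for v
  proof -
    have "vertex_load H z v = (\<Sum>e\<in>S. \<sigma> * ((if v \<in> e then 1 else 0) * y e))"
      unfolding vertex_load_def using H(1)
      by (intro sum.mono_neutral_cong) (auto simp: S_def z_def)
    also have "\<dots> = 0" using y(2) that by (simp add: sum_distrib_left[symmetric])
    finally show ?thesis .
  qed
  ultimately show ?thesis unfolding T_def by (intro exI[of _ z]) blast
qed

text \<open>As long as all edges are light and some weight is nonzero, \<open>w\<close> is moved
  along such a direction until a new constraint becomes tight. The number of support edges plus the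
  number of slack vertices then drops, which bounds the number of moves.\<close>

lemma exists_heavy_edge:
  assumes H: "finite H" "\<And>e. e \<in> H \<Longrightarrow> finite e" "\<And>e. e \<in> H \<Longrightarrow> e \<noteq> {}"
      "\<And>e. e \<in> H \<Longrightarrow> card e \<le> r"
    and "fractional_matching H w"
  shows "\<exists>w' :: 'a set \<Rightarrow> real. fractional_matching H w' \<and> sum w H \<le> sum w' H \<and>
           ((\<forall>e\<in>H. w' e = 0) \<or> (\<exists>e\<in>H. 1 \<le> r * w' e))"
  using assms(5)
proof (induction "card {e\<in>H. w e \<noteq> 0} + card {v\<in>\<Union>H. vertex_load H w v \<noteq> 1}"
    arbitrary: w rule: less_induct)
  case less
  note w = less.prems
  show ?case
  proof (cases "(\<forall>e\<in>H. w e = 0) \<or> (\<exists>e\<in>H. 1 \<le> r * w e)")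
    case True
    with w show ?thesis by (intro exI[of _ w]) auto
  next
    case False
    then obtain e0 where e0: "e0 \<in> H" "w e0 \<noteq> 0" by blast
    have "\<exists>z :: 'a set \<Rightarrow> real. (\<exists>e\<in>H. z e \<noteq> 0) \<and> (\<forall>e\<in>H. w e = 0 \<longrightarrow> z e = 0) \<and> 0 \<le> sum z H \<and>
           (\<forall>v\<in>\<Union>H. vertex_load H w v = 1 \<longrightarrow> vertex_load H z v = 0)"
      using False by (intro light_matching_direction[OF H(1,2,4) w _ e0]) auto
    then obtain z :: "'a set \<Rightarrow> real" where z: "\<exists>e\<in>H. z e \<noteq> 0" "\<And>e. e \<in> H \<Longrightarrow> w e = 0 \<Longrightarrow> z e = 0"
      "0 \<le> sum z H"
      "\<And>v. v \<in> \<Union>H \<Longrightarrow> vertex_load H w v = 1 \<Longrightarrow> vertex_load H z v = 0" by blast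
    \<comment> \<open>The constraints along the ray \<open>w + s * z\<close>: nonnegative edge
      weights, and nonnegative slack at the vertices.\<close>
    define P where "P = (\<lambda>e. (w e, z e)) ` H \<union>
      (\<lambda>v. (1 - vertex_load H w v, - vertex_load H z v)) ` \<Union>H"
    have finV: "finite (\<Union>H)" using H by blast
    have finP: "finite P" using H(1) finV by (simp add: P_def)
    have nonneg: "0 \<le> a" if "(a, b) \<in> P" for a b
      using that w by (auto simp: P_def fractional_matching_def)
    \<comment> \<open>The ray must leave the polytope: if no edge weight decreases, some edge gains
      weight, and the slack at any vertex of that edge decreases.\<close>
    have "\<exists>(a, b)\<in>P. b < 0"
    proof (cases "\<exists>e\<in>H. z e < 0")
      case True
      then show ?thesis by (force simp: P_def)
    next
      case z_nonneg: False
      with z(1) obtain e where e: "e \<in> H" "0 < z e" by force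
      with H(3) obtain v where v: "v \<in> e" by blast
      have "z e \<le> vertex_load H z v"
        unfolding vertex_load_def using H(1) e v z_nonneg
        by (intro member_le_sum) force+
      with e v show ?thesis by (force simp: P_def)
    qed
    then obtain a0 b0 where "(a0, b0) \<in> P" "b0 < 0" by blast
    with finP nonneg obtain s a b where
      s: "0 \<le> s" "\<forall>(a, b)\<in>P. 0 \<le> a + s * b" and
      ab: "(a, b) \<in> P" "b < 0" "a + s * b = 0"
      by (rule ray_exits_polyhedron)
    define w' where "w' e = w e + s * z e" for e
    have load: "vertex_load H w' v = vertex_load H w v + s * vertex_load H z v" for v
      unfolding w'_def by (rule vertex_load_add_scaled)
    have nonneg': "0 \<le> w' e" if "e \<in> H" for e
      using bspec[OF s(2), of "(w e, z e)"] that by (simp add: P_def w'_def)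
    have load_le: "vertex_load H w' v \<le> 1" for v
    proof (cases "v \<in> \<Union>H")
      case True
      then show ?thesis
        using bspec[OF s(2), of "(1 - vertex_load H w v, - vertex_load H z v)"]
        by (simp add: P_def load)
    next
      case False
      then have "{e\<in>H. v \<in> e} = {}" by auto
      then show ?thesis by (simp only: vertex_load_def sum.empty)
    qed
    have fm': "fractional_matching H w'"
      using nonneg' load_le by (simp add: fractional_matching_def)
    have weight: "sum w H \<le> sum w' H"
      using s(1) z(3) by (simp add: w'_def sum.distrib sum_distrib_left[symmetric])
    define S where "S u = {e\<in>H. u e \<noteq> 0}" for u :: "'a set \<Rightarrow> real"
    define L where "L u = {v\<in>\<Union>H. vertex_load H u v \<noteq> 1}" for u
    have fin: "finite (S w)" "finite (L w)" unfolding S_def L_def using H(1) finV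
      by (auto intro: finite_subset[of _ H] finite_subset[of _ "\<Union>H"])
    have sub: "S w' \<subseteq> S w" "L w' \<subseteq> L w"
      using z(2,4) unfolding S_def L_def w'_def[of "_ :: 'a set"] load by fastforce+
    from ab(1) consider e where "e \<in> H" "a = w e" "b = z e"
      | v where "v \<in> \<Union>H" "a = 1 - vertex_load H w v" "b = - vertex_load H z v"
      unfolding P_def by blast
    \<comment> \<open>The constraint that has become tight was slack before, because
      \<open>z\<close> vanishes on edges of weight zero and has zero load at tight vertices.\<close>
    then have "S w' \<subset> S w \<or> L w' \<subset> L w"
    proof cases
      case 1
      with ab z(2)[of e] have "e \<in> S w - S w'" by (auto simp: S_def w'_def)
      with sub show ?thesis by blast
    next
      case 2
      with ab z(4)[of v] have "v \<in> L w - L w'" by (auto simp: L_def load)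
      with sub show ?thesis by blast
    qed
    then have "card (S w') + card (L w') < card (S w) + card (L w)"
      using psubset_card_mono[OF fin(1), of "S w'"] psubset_card_mono[OF fin(2), of "L w'"]
        card_mono[OF fin(1) sub(1)] card_mono[OF fin(2) sub(2)] by linarith
    from less.hyps[OF this[unfolded S_def L_def] fm'] weight
    show ?thesis by (meson order_trans)
  qed
qed

text \<open>The total load on the vertices of \<open>e\<close> is at most \<open>card e\<close>; it
  counts \<open>e\<close> itself \<open>card e\<close> times and every other edge meeting
  \<open>e\<close> at least once. If \<open>w e\<close> is at least \<open>1 / r\<close>, the bound
  is at most \<open>r - 1 + 1 / r\<close>.\<close>

lemma fractional_matching_neighbourhood:
  assumes H: "finite H" "e \<in> H" "finite e" "e \<noteq> {}" "card e \<le> r"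
    and w: "fractional_matching H w"
  shows "sum w {f\<in>H. f \<inter> e \<noteq> {}} \<le> r - (real r - 1) * w e"
proof -
  define N where "N = {f\<in>H. f \<inter> e \<noteq> {}}"
  have N: "finite N" "e \<in> N" using H by (auto simp: N_def)
  have wpos: "0 \<le> w f" if "f \<in> H" for f using w that by (simp add: fractional_matching_def)
  have "(\<Sum>f\<in>N. w f) - w e + w e * card e = w e * card e + (\<Sum>f\<in>N - {e}. w f)"
    using N by (simp add: sum_diff1)
  also have "\<dots> \<le> w e * card e + (\<Sum>f\<in>N - {e}. w f * card (f \<inter> e))"
  proof (intro add_left_mono sum_mono)
    fix f assume "f \<in> N - {e}"
    then have "f \<in> H" "f \<inter> e \<noteq> {}" by (auto simp: N_def)
    then have "1 \<le> real (card (f \<inter> e))" using H(3)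
      by (metis One_nat_def Suc_leI card_gt_0_iff finite_Int of_nat_1 of_nat_mono)
    from mult_left_mono[OF this wpos[OF \<open>f \<in> H\<close>]] show "w f \<le> w f * card (f \<inter> e)" by simp
  qed
  also have "\<dots> = (\<Sum>f\<in>N. w f * card (f \<inter> e))"
    using N by (simp add: sum.remove[of N e])
  also have "\<dots> = (\<Sum>v\<in>e. vertex_load H w v)"
    unfolding sum_vertex_load[OF H(1,3)] using H(1)
    by (intro sum.mono_neutral_left) (auto simp: N_def)
  also have "\<dots> \<le> (\<Sum>v\<in>e. 1)"
    using w by (intro sum_mono) (simp add: fractional_matching_def)
  finally have "sum w N \<le> card e * (1 - w e) + w e" by (simp add: algebra_simps)
  also have "\<dots> \<le> r * (1 - w e) + w e"
    using fractional_matching_le_1[OF w H(1,2,4)] H(5)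
    by (intro add_right_mono mult_right_mono) auto
  finally show ?thesis by (simp add: N_def algebra_simps)
qed

text \<open>Greedy choice: take a heavy edge, discard all edges meeting it, and recurse on the rest.
  Each round costs at most \<open>r - 1 + 1 / r\<close> of weight, which is
  \<open>r\<^sup>2 - r + 1\<close> after scaling by \<open>r\<close>. The weights are rearranged
  anew in each round, so the induction has to generalise over \<open>w\<close>.\<close>

lemma exists_large_matching:
  assumes "finite H" "\<And>e. e \<in> H \<Longrightarrow> finite e" "\<And>e. e \<in> H \<Longrightarrow> e \<noteq> {}"
    "\<And>e. e \<in> H \<Longrightarrow> card e \<le> r" "fractional_matching H w"
  shows "\<exists>M\<subseteq>H. disjoint M \<and> r * sum w H \<le> card M * ((real r)\<^sup>2 - r + 1)"
  using assms
proof (induction H arbitrary: w rule: finite_psubset_induct)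
  case (psubset H)
  have "\<exists>w' :: 'a set \<Rightarrow> real. fractional_matching H w' \<and> sum w H \<le> sum w' H \<and>
      ((\<forall>e\<in>H. w' e = 0) \<or> (\<exists>e\<in>H. 1 \<le> r * w' e))"
    using psubset.hyps psubset.prems by (rule exists_heavy_edge)
  then obtain w' :: "'a set \<Rightarrow> real" where w': "fractional_matching H w'"
    "sum w H \<le> sum w' H" "(\<forall>e\<in>H. w' e = 0) \<or> (\<exists>e\<in>H. 1 \<le> r * w' e)" by blast
  show ?case
  proof (cases "\<forall>e\<in>H. w' e = 0")
    case True
    then have "sum w H \<le> 0" using w'(2) by simp
    then show ?thesis by (intro exI[of _ "{}"]) (simp add: mult_nonneg_nonpos)
  next
    case False
    then obtain e where e: "e \<in> H" "1 \<le> r * w' e" using w'(3) by blast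
    define R where "R = {f\<in>H. f \<inter> e = {}}"
    have "R \<subset> H" using e psubset(4)[of e] by (auto simp: R_def)
    moreover have "fractional_matching R w'"
      using fractional_matching_mono[OF w'(1) psubset(1)] \<open>R \<subset> H\<close> by blast
    moreover have "R \<subseteq> H" by (auto simp: R_def)
    ultimately have "\<exists>M\<subseteq>R. disjoint M \<and> r * sum w' R \<le> card M * ((real r)\<^sup>2 - r + 1)"
      using psubset.prems(1-3) by (intro psubset.IH) auto
    then obtain M where M: "M \<subseteq> R" "disjoint M"
      "r * sum w' R \<le> card M * ((real r)\<^sup>2 - r + 1)" by blast
    have "finite M" using M(1) psubset(1) by (auto simp: R_def intro: finite_subset)
    have "e \<notin> M" using M(1) psubset(4)[OF e(1)] by (auto simp: R_def)
    have "1 \<le> real r"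
      using psubset(3-5)[OF e(1)] card_gt_0_iff[of e] by linarith
    have "sum w' H = sum w' R + sum w' {f\<in>H. f \<inter> e \<noteq> {}}"
      using psubset(1) unfolding R_def
      by (subst sum.union_disjoint[symmetric]) (auto intro: sum.cong)
    also have "r * \<dots> \<le> r * sum w' R + r * (r - (real r - 1) * w' e)"
      using fractional_matching_neighbourhood[OF psubset(1) e(1) psubset(3-5)[OF e(1)] w'(1)]
      by (simp add: distrib_left mult_left_mono)
    \<comment> \<open>Regrouped so that the heaviness \<open>1 \<le> r * w' e\<close> can be
      inserted.\<close>
    also have "r * (r - (real r - 1) * w' e) = (real r)\<^sup>2 - (real r - 1) * (r * w' e)"
      by (simp add: algebra_simps power2_eq_square)
    also have "\<dots> \<le> (real r)\<^sup>2 - (real r - 1) * 1"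
      using e(2) \<open>1 \<le> real r\<close> by (intro diff_left_mono mult_left_mono) auto
    finally have "r * sum w' H \<le> card M * ((real r)\<^sup>2 - r + 1) + ((real r)\<^sup>2 - r + 1)"
      using M(3) by simp
    moreover have "r * sum w H \<le> r * sum w' H" using w'(2) by (simp add: mult_left_mono)
    ultimately have "r * sum w H \<le> card (insert e M) * ((real r)\<^sup>2 - r + 1)"
      using \<open>finite M\<close> \<open>e \<notin> M\<close> by (simp add: distrib_right)
    moreover have "insert e M \<subseteq> H" using e(1) M(1) by (auto simp: R_def)
    moreover have "disjoint (insert e M)"
      using M(1,2) by (auto simp: R_def disjoint_def)
    ultimately show ?thesis by blast
  qed
qed

lemma regular_uniform_matching:
  assumes F: "F \<subseteq> Pow {1..n}" "uniform_hypergraph q F" "regular_hypergraph n F"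
    and "F \<noteq> {}" "q \<ge> 1"
  shows "\<exists>M\<subseteq>F. disjoint M \<and> real n \<le> card M * ((real q)\<^sup>2 - q + 1)"
proof -
  have fin: "finite F" using F(1) by (auto intro: finite_subset)
  have edge: "finite e" "card e = q" "e \<noteq> {}" "e \<subseteq> {1..n}" if "e \<in> F" for e
    using F that \<open>q \<ge> 1\<close> by (auto simp: uniform_hypergraph_def intro: finite_subset)
  obtain d where d: "\<And>i. i \<in> {1..n} \<Longrightarrow> card {A\<in>F. i \<in> A} = d"
    using F(3) by (auto simp: regular_hypergraph_def)
  \<comment> \<open>A vertex on an edge shows that the common degree is positive, so that the weight
    \<open>1 / d\<close> gives load exactly 1 at every vertex of the ground set.\<close>
  obtain e i where ei: "e \<in> F" "i \<in> e" using \<open>F \<noteq> {}\<close> edge(3) by blast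
  then have "e \<in> {A\<in>F. i \<in> A}" by simp
  then have "card {A\<in>F. i \<in> A} > 0" using fin by (subst card_gt_0_iff) auto
  then have d0: "d > 0" using d[of i] edge(4)[OF ei(1)] ei(2) by auto
  define w :: "nat set \<Rightarrow> real" where "w e = 1 / d" for e
  have load: "vertex_load F w v = (if v \<in> {1..n} then 1 else 0)" for v
  proof (cases "v \<in> {1..n}")
    case True
    then show ?thesis using d[OF True] d0 by (simp add: vertex_load_def w_def)
  next
    case False
    then have "{A\<in>F. v \<in> A} = {}" using edge(4) by blast
    then show ?thesis using False by (simp only: vertex_load_def sum.empty if_False)
  qed
  have "fractional_matching F w" by (simp add: fractional_matching_def load) (simp add: w_def)
  then obtain M where M: "M \<subseteq> F" "disjoint M" "q * sum w F \<le> card M * ((real q)\<^sup>2 - q + 1)"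
    using exists_large_matching[of F q w] fin edge by auto
  have "real n = (\<Sum>v\<in>{1..n}. vertex_load F w v)" by (simp add: load)
  also have "\<dots> = (\<Sum>e\<in>F. w e * q)"
    unfolding sum_vertex_load[OF fin finite_atLeastAtMost]
    by (intro sum.cong refl) (simp only: edge Int_absorb2)
  also have "\<dots> = q * sum w F" by (simp add: sum_distrib_left mult.commute)
  finally show ?thesis using M by auto
qed

section \<open>The two characteristics of a complex\<close>

lemma nonface_contains_minimal_nonface:
  assumes "A \<subseteq> {1..n}" "A \<notin> K"
  shows "\<exists>B\<in>minimal_nonfaces n K. B \<subseteq> A"
proof -
  have "finite A" using assms(1) by (rule finite_subset) simp
  then show ?thesis using assms
  proof (induction A rule: finite_psubset_induct)
    case (psubset A)
    show ?case
    proof (cases "\<exists>B. B \<subset> A \<and> B \<notin> K")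
      case True
      then obtain B where B: "B \<subset> A" "B \<notin> K" by blast
      then have "B \<subseteq> {1..n}" using psubset.prems(1) by blast
      then show ?thesis using psubset.IH[OF B(1) _ B(2)] B(1) by blast
    next
      case False
      then have "A \<in> minimal_nonfaces n K"
        using psubset.prems unfolding minimal_nonfaces_def by blast
      then show ?thesis by blast
    qed
  qed
qed

text \<open>Otherwise \<open>partition_number n K\<close> many edges of \<open>M\<close>, one of
  them enlarged by all uncovered vertices, would form a partition into non-faces with a forbidden
  number of blocks.\<close>

lemma partition_number_gt_card_matching:
  assumes K: "simplicial_complex n K"
    and M: "M \<subseteq> minimal_nonfaces n K" "disjoint M"
  shows "card M < partition_number n K"
proof -
  define Q where "Q k \<longleftrightarrow> 1 \<le> k \<and> (\<forall>A :: nat \<Rightarrow> nat set.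
      disjoint_family_on A {1..k} \<and> (\<Union>i\<in>{1..k}. A i) = {1..n} \<longrightarrow> (\<exists>i\<in>{1..k}. A i \<in> K))" for k
  \<comment> \<open>The least number in the definition is attained: among \<open>n + 1\<close>
    disjoint blocks of an \<open>n\<close>-set one is empty, hence a face.\<close>
  have "Q (Suc n)"
    unfolding Q_def
  proof (intro conjI allI impI; (elim conjE)?)
    fix A :: "nat \<Rightarrow> nat set"
    assume A: "disjoint_family_on A {1..Suc n}" "(\<Union>i\<in>{1..Suc n}. A i) = {1..n}"
    have "\<exists>i\<in>{1..Suc n}. A i = {}"
    proof (rule ccontr)
      assume "\<not> ?thesis"
      then have "\<forall>i\<in>{1..Suc n}. \<exists>x. x \<in> A i" by blast
      then obtain g where g: "\<And>i. i \<in> {1..Suc n} \<Longrightarrow> g i \<in> A i" by metis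
      have "inj_on g {1..Suc n}"
        using g A(1) by (intro inj_onI) (metis IntI disjoint_family_onD empty_iff)
      moreover have "g ` {1..Suc n} \<subseteq> {1..n}" using g A(2) by blast
      ultimately have "card {1..Suc n} \<le> card {1..n}" by (intro card_inj_on_le) auto
      then show False by simp
    qed
    then show "\<exists>i\<in>{1..Suc n}. A i \<in> K" using K by (metis simplicial_complex_def)
  qed simp
  then have Q: "Q (partition_number n K)"
    unfolding partition_number_def Q_def by (rule LeastI)
  show ?thesis
  proof (rule ccontr)
    define k where "k = partition_number n K"
    assume "\<not> ?thesis"
    then have "k \<le> card M" by (simp add: k_def)
    have nonface: "e \<subseteq> {1..n}" "e \<notin> K" if "e \<in> M" for e
      using M(1) that by (auto simp: minimal_nonfaces_def)
    have "M \<subseteq> Pow {1..n}" using nonface by blast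
    then have "finite M" by (rule finite_subset) simp
    then obtain h where h: "bij_betw h {1..card M} M" using ex_bij_betw_nat_finite_1 by blast
    have k1: "1 \<le> k" using Q by (simp add: Q_def k_def)
    have hM: "h i \<in> M" if "i \<in> {1..k}" for i
      using h that \<open>k \<le> card M\<close> by (auto simp: bij_betw_def)
    have hdisj: "h i \<inter> h j = {}" if "i \<in> {1..k}" "j \<in> {1..k}" "i \<noteq> j" for i j
    proof -
      have "h i \<noteq> h j" using h that \<open>k \<le> card M\<close> by (auto simp: bij_betw_def dest: inj_onD)
      then show ?thesis using M(2) hM that by (auto simp: disjoint_def)
    qed
    \<comment> \<open>The first block absorbs every vertex outside the other chosen edges; by
      disjointness it still contains \<open>h 1\<close>, so it is a non-face.\<close>
    define A where "A i = (if i = 1 then {1..n} - (\<Union>j\<in>{2..k}. h j) else h i)" for i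
    have "disjoint_family_on A {1..k}"
      using hdisj by (auto simp: disjoint_family_on_def A_def)
    moreover have "(\<Union>i\<in>{1..k}. A i) = {1..n}"
    proof
      show "(\<Union>i\<in>{1..k}. A i) \<subseteq> {1..n}"
        using nonface(1) hM by (fastforce simp: A_def split: if_splits)
      show "{1..n} \<subseteq> (\<Union>i\<in>{1..k}. A i)"
      proof
        fix x assume x: "x \<in> {1..n}"
        show "x \<in> (\<Union>i\<in>{1..k}. A i)"
        proof (cases "\<exists>j\<in>{2..k}. x \<in> h j")
          case True
          then obtain j where "j \<in> {2..k}" "x \<in> h j" by blast
          then show ?thesis by (intro UN_I[of j]) (auto simp: A_def)
        next
          case False
          then show ?thesis using x k1 by (intro UN_I[of 1]) (auto simp: A_def)
        qed
      qed
    qed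
    ultimately obtain i where i: "i \<in> {1..k}" "A i \<in> K"
      using Q unfolding Q_def k_def[symmetric] by blast
    have "h i \<subseteq> A i"
    proof (cases "i = 1")
      case True
      have "h 1 \<inter> h j = {}" if "j \<in> {2..k}" for j using hdisj[of 1 j] that by auto
      then show ?thesis using True nonface(1)[OF hM[OF i(1)]] unfolding A_def by force
    qed (simp add: A_def)
    then have "h i \<in> K" using K i(2) by (auto simp: simplicial_complex_def)
    then show False using nonface(2) hM[OF i(1)] by blast
  qed
qed

text \<open>Under the uniform measure a set of measure below \<open>q / n\<close> has fewer than
  \<open>q\<close> elements. Only values strictly below \<open>q / n\<close> are shown to be
  admissible, so the supremum is approached from below.\<close>

lemma threshold_char_ge:
  assumes "n \<ge> 1" and small: "\<And>A. A \<subseteq> {1..n} \<Longrightarrow> card A < q \<Longrightarrow> A \<in> K"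
  shows "ennreal (q / n) \<le> threshold_char n K"
proof (rule dense_le)
  fix \<alpha> assume \<alpha>: "\<alpha> < ennreal (q / n)"
  define x :: "nat \<Rightarrow> real" where "x i = 1 / n" for i
  have "x \<in> prob_simplex n" using assms(1) by (simp add: x_def prob_simplex_def)
  moreover have "threshold_complex n x \<alpha> \<subseteq> K"
  proof
    fix A assume "A \<in> threshold_complex n x \<alpha>"
    then have A: "A \<subseteq> {1..n}" "ennreal (card A / n) \<le> \<alpha>"
      by (auto simp: threshold_complex_def x_def)
    from A(2) \<alpha> have "ennreal (card A / n) < ennreal (q / n)" by (rule le_less_trans)
    then have "card A < q" using assms(1) by (simp add: ennreal_less_iff divide_less_cancel)
    then show "A \<in> K" using small A(1) by blast
  qed
  ultimately show "\<alpha> \<le> threshold_char n K"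
    unfolding threshold_char_def by (intro Sup_upper) blast
qed

text \<open>The bound on the reciprocal is derived from a product in \<open>ennreal\<close>, which
  covers an infinite threshold characteristic. Here \<open>q\<close> is any size below which all
  sets are faces; it is used both for the edge size and for \<open>n + 1\<close>.\<close>

lemma inverse_threshold_char_le:
  assumes "n \<ge> 1" "q \<ge> 1" "\<And>A. A \<subseteq> {1..n} \<Longrightarrow> card A < q \<Longrightarrow> A \<in> K"
  shows "enn2real (1 / threshold_char n K) \<le> n / q"
proof -
  have pos: "0 < ennreal (q / n)" using assms(1,2) by simp
  have le: "ennreal (q / n) \<le> threshold_char n K" by (rule threshold_char_ge[OF assms(1,3)])
  have "1 = ennreal (q / n) * ennreal (n / q)"
    using assms(1,2) by (simp flip: ennreal_mult)
  also have "\<dots> \<le> threshold_char n K * ennreal (n / q)" using le by (rule mult_right_mono) simp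
  finally have "1 / threshold_char n K \<le> ennreal (n / q)"
    using less_le_trans[OF pos le] by (intro divide_le_posI_ennreal)
  then show ?thesis by (intro enn2real_leI) auto
qed

theorem theorem1p8:
  fixes n q :: nat and F K :: "nat set set"
  assumes "q \<ge> 3"
    and "F \<subseteq> Pow {1..n}"
    and "uniform_hypergraph q F"
    and "regular_hypergraph n F"
    and "simplicial_complex n K"
    and "F = minimal_nonfaces n K"
  shows "real_of_int (nonlinearity_gap n K) / real n
           \<le> (real q - 1)\<^sup>2 / (real q * ((real q)\<^sup>2 - real q + 1))
       \<and> (real q - 1)\<^sup>2 / (real q * ((real q)\<^sup>2 - real q + 1)) \<le> 4 / 21"
proof
  define D where "D = (real q)\<^sup>2 - real q + 1"
  have q3: "3 \<le> real q" using assms(1) by simp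
  have "0 \<le> real q * (real q - 1)" using q3 by simp
  then have D0: "0 < D" by (simp add: D_def power2_eq_square algebra_simps)
  \<comment> \<open>The difference of the cross-multiplied sides vanishes at \<open>q = 3\<close>,
    the case of equality, which gives the factor \<open>q - 3\<close>.\<close>
  have "0 \<le> (real q - 3) * ((real q - 3) * (4 * real q - 1) + 4)"
    using q3 by (intro mult_nonneg_nonneg add_nonneg_nonneg) auto
  also have "\<dots> = 4 * (real q * D) - 21 * (real q - 1)\<^sup>2"
    by (simp add: D_def power2_eq_square algebra_simps)
  finally show "(real q - 1)\<^sup>2 / (real q * ((real q)\<^sup>2 - real q + 1)) \<le> 4 / 21"
    using q3 D0 by (simp add: D_def[symmetric] divide_simps)
  show "real_of_int (nonlinearity_gap n K) / real n
      \<le> (real q - 1)\<^sup>2 / (real q * ((real q)\<^sup>2 - real q + 1))"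
  proof (cases "n = 0 \<or> nonlinearity_gap n K \<le> 0")
    case True
    then have "real_of_int (nonlinearity_gap n K) / real n \<le> 0"
      by (auto simp: divide_nonpos_nonneg)
    also have "0 \<le> (real q - 1)\<^sup>2 / (real q * D)" using D0 by simp
    finally show ?thesis by (simp add: D_def)
  next
    case False
    then have n1: "n \<ge> 1" by simp
    \<comment> \<open>The strict inequality between \<open>card M\<close> and the partition number
      absorbs the summand 1 of the gap.\<close>
    have gap: "nonlinearity_gap n K \<le> \<lfloor>enn2real (1 / threshold_char n K)\<rfloor> - int (card M)"
      if "M \<subseteq> F" "disjoint M" for M
      using partition_number_gt_card_matching[OF assms(5), of M] that
      by (simp add: assms(6) nonlinearity_gap_def)
    have small: "A \<in> K" if A: "A \<subseteq> {1..n}" "card A < p" "F = {} \<or> p \<le> q" for A p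
    proof (rule ccontr)
      assume "A \<notin> K"
      then obtain B where B: "B \<in> F" "B \<subseteq> A"
        using nonface_contains_minimal_nonface[OF A(1)] assms(6) by blast
      have "finite A" using A(1) by (rule finite_subset) simp
      then have "q \<le> card A"
        using card_mono[OF _ B(2)] B(1) assms(3) by (auto simp: uniform_hypergraph_def)
      with A B show False by auto
    qed
    \<comment> \<open>Without edges every subset of the ground set is a face, so the size bound
      \<open>n + 1\<close> applies; then \<open>1 / \<rho>(K)\<close> is below 1, its floor is at
      most 0, and the gap is not positive.\<close>
    have "F \<noteq> {}"
    proof
      assume "F = {}"
      then have "enn2real (1 / threshold_char n K) \<le> n / (n + 1)"
        using small by (intro inverse_threshold_char_le[OF n1]) auto
      also have "\<dots> < 1" by simp
      finally have "\<lfloor>enn2real (1 / threshold_char n K)\<rfloor> \<le> 0"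
        by (simp add: floor_le_iff)
      with gap[of "{}"] False show False by simp
    qed
    then obtain M where M: "M \<subseteq> F" "disjoint M" "real n \<le> card M * D"
      using regular_uniform_matching[OF assms(2-4)] assms(1) by (auto simp: D_def)
    have "enn2real (1 / threshold_char n K) \<le> n / q"
      using small assms(1) by (intro inverse_threshold_char_le[OF n1]) auto
    then have "real_of_int (nonlinearity_gap n K) \<le> n / q - card M"
      using gap[OF M(1,2)] by linarith
    also have "\<dots> \<le> n / q - n / D" using M(3) D0 by (simp add: pos_divide_le_eq)
    \<comment> \<open>The bound is the distance between the fractional value \<open>n / q\<close>
      and the guaranteed matching size \<open>n / D\<close>; its numerator \<open>D - q\<close> is a
      perfect square.\<close>
    also have "\<dots> = n * ((D - q) / (q * D))" using D0 q3 by (simp add: field_simps)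
    also have "D - q = (real q - 1)\<^sup>2" by (simp add: D_def power2_eq_square algebra_simps)
    finally show ?thesis using n1 by (simp add: pos_divide_le_eq mult.commute flip: D_def)
  qed
qed

end
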